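(* The congruences $\sim_c$ and $\sim_\rho$ on $\mathcal W$ are incomparable: $\sim_\rho\not\subseteq\sim_c$ and $\sim_c\not\subseteq\sim_\rho$.
   Context: $Q_3$ is the $1$-skeleton (graph) of the three-dimensional cube, with vertex set $V=\{0,1\}^3$ and coordinates numbered $0,1,2$; two vertices are adjacent iff they differ in exactly one coordinate. A vertex is written $b_2b_1b_0$ ($b_i$ the $i$-th coordinate) and identified with the integer $4b_2+2b_1+b_0\in\{0,\ldots,7\}$. The basepoint is $o=000$. A walk is $w=(o;a_1a_2\cdots a_n)$ with $n\ge0$, $a_k\in\{0,1,2\}$; its vertex sequence is $v_0=o,v_1,\ldots,v_n$, where $v_k$ is obtained from $v_{k-1}$ by flipping coordinate $a_k$. It is closed if $v_n=o$. $\mathcal W$ is the monoid of based closed walks under concatenation of step sequences. Reduced loop word: fix the spanning tree of $Q_3$ given by the path $000,001,011,010,110,111,101,100$ (i.e. $0,1,3,2,6,7,5,4$). The five remaining (cotree) edges $(0,2),(0,4),(1,5),(3,7),(4,6)$ are oriented from the smaller to the larger integer and denoted $x_1,\ldots,x_5$ in this order; $F_5$ is the free group on $x_1,\ldots,x_5$. For $w\in\mathcal W$, reading the steps in order, a forward crossing of the $i$-th cotree edge contributes $x_i$, a backward crossing contributes $x_i^{-1}$, and a tree edge contributes nothing; $\rho(w)\in F_5$ is the free reduction of the resulting word. Directed transition count: $\tau_w:V\times V\to\mathbb N$, $\tau_w(p,q)=\#\{k:1\le k\le n,\ (v_{k-1},v_k)=(p,q)\}$. $\mathbb H_{\mathbb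 Z}=\{a+b\mathbf i+c\mathbf j+d\mathbf k:a,b,c,d\in\mathbb Z\}$ is the multiplicative monoid of integer quaternions, with $\mathbf i^2=\mathbf j^2=\mathbf k^2=-1$, $\mathbf i\mathbf j=\mathbf k$, $\mathbf j\mathbf k=\mathbf i$, $\mathbf k\mathbf i=\mathbf j$. Put $q_0=1+\mathbf i$, $q_1=1+\mathbf j$, $q_2=1+\mathbf k$, $h(w)=q_{a_1}\cdots q_{a_n}\in\mathbb H_{\mathbb Z}$ for $w=(o;a_1\cdots a_n)$, and $c(w)=(\tau_w,h(w))$. For a map $r$ on $\mathcal W$, $x\sim_r y\iff r(x)=r(y)$. Relations are compared as subsets of $\mathcal W\times\mathcal W$. *)

theory Defs
  imports Main
begin

section \<open>Based closed walks on the cube graph\<close>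

text \<open>The vertex \<open>b\<^sub>2b\<^sub>1b\<^sub>0\<close> is the triple \<open>(b\<^sub>2, b\<^sub>1, b\<^sub>0)\<close>, with \<^const>\<open>True\<close> standing for 1.\<close>

type_synonym vertex = "bool \<times> bool \<times> bool"

fun coord :: "nat \<Rightarrow> vertex \<Rightarrow> bool" where
  "coord a (b2, b1, b0) = (if a = 0 then b0 else if a = 1 then b1 else b2)"

fun vertex_num :: "vertex \<Rightarrow> nat" where
  "vertex_num (b2, b1, b0) = 4 * of_bool b2 + 2 * of_bool b1 + of_bool b0"

definition adjacent :: "vertex \<Rightarrow> vertex \<Rightarrow> bool" where
  "adjacent p q \<longleftrightarrow> card {a \<in> {0, 1, 2}. coord a p \<noteq> coord a q} = 1"

definition basepoint :: vertex where
  "basepoint = (False, False, False)"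

fun flip :: "nat \<Rightarrow> vertex \<Rightarrow> vertex" where
  "flip a (b2, b1, b0) = (b2 \<noteq> (a = 2), b1 \<noteq> (a = 1), b0 \<noteq> (a = 0))"

lemma adjacent_iff_flip: "adjacent p q \<longleftrightarrow> (\<exists>a \<in> {0, 1, 2}. q = flip a p)"
proof -
  have eq: "{a \<in> {0, 1, 2}. P a}
      = (if P 0 then {0} else {}) \<union> (if P 1 then {1} else {}) \<union> (if P 2 then {2::nat} else {})"
    for P by (auto intro: ccontr)
  show ?thesis
    unfolding adjacent_def eq by (cases p; cases q) auto
qed

text \<open>A walk is represented by its step sequence \<open>a\<^sub>1 \<dots> a\<^sub>n\<close>; \<open>walk_vertex w k\<close> is \<open>v\<^sub>k\<close>.
  List indexing starts at 0, so that \<open>a\<^sub>k\<close> is \<open>w ! (k - 1)\<close>.\<close>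

fun walk_vertex :: "nat list \<Rightarrow> nat \<Rightarrow> vertex" where
  "walk_vertex w 0 = basepoint"
| "walk_vertex w (Suc k) = flip (w ! k) (walk_vertex w k)"

definition closed_walks :: "nat list set" where
  "closed_walks = {w. set w \<subseteq> {0, 1, 2} \<and> walk_vertex w (length w) = basepoint}"

text \<open>The pairs \<open>(v\<^sub>k\<^sub>-\<^sub>1, v\<^sub>k)\<close> for \<open>k = 1, \<dots>, n\<close>, in order.\<close>

definition traversals :: "nat list \<Rightarrow> (vertex \<times> vertex) list" where
  "traversals w = map (\<lambda>k. (walk_vertex w (k - 1), walk_vertex w k)) [1..<length w + 1]"


section \<open>The reduced loop word\<close>

definition tree_path :: "nat list" where
  "tree_path = [0, 1, 3, 2, 6, 7, 5, 4]"

definition cotree_edges :: "(nat \<times> nat) list" where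
  "cotree_edges = [(0, 2), (0, 4), (1, 5), (3, 7), (4, 6)]"

lemma cotree_edges_complement:
  assumes "vertex_num p < vertex_num q"
  shows "(vertex_num p, vertex_num q) \<in> set cotree_edges \<longleftrightarrow>
    adjacent p q \<and>
    (vertex_num p, vertex_num q) \<notin> set (zip tree_path (tl tree_path)) \<and>
    (vertex_num q, vertex_num p) \<notin> set (zip tree_path (tl tree_path))"
  using assms unfolding adjacent_iff_flip cotree_edges_def tree_path_def
  by (cases p; cases q) (auto split: if_splits)

text \<open>\<open>(i, True)\<close> is the letter \<open>x\<^sub>i\<close> and \<open>(i, False)\<close> its inverse. An element of the free group
  is represented by the unique freely reduced word for it.\<close>

type_synonym letter = "nat \<times> bool"

definition inv_letter :: "letter \<Rightarrow> letter" where
  "inv_letter x = (fst x, \<not> snd x)"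

definition reduced :: "letter list \<Rightarrow> bool" where
  "reduced u \<longleftrightarrow> (\<forall>k. Suc k < length u \<longrightarrow> u ! Suc k \<noteq> inv_letter (u ! k))"

inductive cancels :: "letter list \<Rightarrow> letter list \<Rightarrow> bool" where
  "cancels (u @ [x, inv_letter x] @ v) (u @ v)"

fun push :: "letter \<Rightarrow> letter list \<Rightarrow> letter list" where
  "push x [] = [x]"
| "push x (y # ys) = (if y = inv_letter x then ys else x # y # ys)"

definition free_reduce :: "letter list \<Rightarrow> letter list" where
  "free_reduce u = foldr push u []"

definition crossing :: "vertex \<times> vertex \<Rightarrow> letter list" where
  "crossing = (\<lambda>(p, q). concat (map (\<lambda>i.
     if (vertex_num p, vertex_num q) = cotree_edges ! (i - 1) then [(i, True)]
     else if (vertex_num q, vertex_num p) = cotree_edges ! (i - 1) then [(i, False)]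
     else []) [1..<6]))"

definition loop_word :: "nat list \<Rightarrow> letter list" where
  "loop_word w = free_reduce (concat (map crossing (traversals w)))"


section \<open>Integer quaternions\<close>

datatype int_quat = Quat (re: int) (im_i: int) (im_j: int) (im_k: int)

lemma int_quat_eqI:
  "re x = re y \<Longrightarrow> im_i x = im_i y \<Longrightarrow> im_j x = im_j y \<Longrightarrow> im_k x = im_k y \<Longrightarrow> x = y"
  by (simp add: int_quat.expand)

instantiation int_quat :: ring_1
begin

definition "0 = Quat 0 0 0 0"
definition "1 = Quat 1 0 0 0"
definition "x + y = Quat (re x + re y) (im_i x + im_i y) (im_j x + im_j y) (im_k x + im_k y)"
definition "x - y = Quat (re x - re y) (im_i x - im_i y) (im_j x - im_j y) (im_k x - im_k y)"
definition "- x = Quat (- re x) (- im_i x) (- im_j x) (- im_k x)"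
definition "x * y = Quat
  (re x * re y - im_i x * im_i y - im_j x * im_j y - im_k x * im_k y)
  (re x * im_i y + im_i x * re y + im_j x * im_k y - im_k x * im_j y)
  (re x * im_j y - im_i x * im_k y + im_j x * re y + im_k x * im_i y)
  (re x * im_k y + im_i x * im_j y - im_j x * im_i y + im_k x * re y)"

instance
  by standard
    (simp_all add: zero_int_quat_def one_int_quat_def plus_int_quat_def minus_int_quat_def
      uminus_int_quat_def times_int_quat_def algebra_simps)

end

definition quat_i :: int_quat where "quat_i = Quat 0 1 0 0"
definition quat_j :: int_quat where "quat_j = Quat 0 0 1 0"
definition quat_k :: int_quat where "quat_k = Quat 0 0 0 1"

lemma quat_units:
  "quat_i * quat_i = - 1" "quat_j * quat_j = - 1" "quat_k * quat_k = - 1"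
  "quat_i * quat_j = quat_k" "quat_j * quat_k = quat_i" "quat_k * quat_i = quat_j"
  by (simp_all add: quat_i_def quat_j_def quat_k_def one_int_quat_def uminus_int_quat_def
      times_int_quat_def)

definition step_quat :: "nat \<Rightarrow> int_quat" where
  "step_quat a = [1 + quat_i, 1 + quat_j, 1 + quat_k] ! a"

definition holonomy :: "nat list \<Rightarrow> int_quat" where
  "holonomy w = prod_list (map step_quat w)"


section \<open>The two invariants and their kernel relations\<close>

definition transition_count :: "nat list \<Rightarrow> vertex \<times> vertex \<Rightarrow> nat" where
  "transition_count w = (\<lambda>(p, q).
     card {k. 1 \<le> k \<and> k \<le> length w \<and> (walk_vertex w (k - 1), walk_vertex w k) = (p, q)})"

definition charge :: "nat list \<Rightarrow> (vertex \<times> vertex \<Rightarrow> nat) \<times> int_quat" where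
  "charge w = (transition_count w, holonomy w)"

definition kernel_rel :: "(nat list \<Rightarrow> 'a) \<Rightarrow> (nat list \<times> nat list) set" where
  "kernel_rel r = {(x, y). x \<in> closed_walks \<and> y \<in> closed_walks \<and> r x = r y}"


section \<open>Free reduction is well defined\<close>

lemma inv_letter_inv [simp]: "inv_letter (inv_letter x) = x"
  by (simp add: inv_letter_def)

lemma reduced_Nil [simp]: "reduced []"
  by (simp add: reduced_def)

lemma reduced_Cons:
  "reduced (x # u) \<longleftrightarrow> reduced u \<and> (u = [] \<or> hd u \<noteq> inv_letter x)"
proof -
  have "(\<forall>k. P k) \<longleftrightarrow> P 0 \<and> (\<forall>k. P (Suc k))" for P :: "nat \<Rightarrow> bool"
    using not0_implies_Suc by metis
  from this[of "\<lambda>k. Suc k < length (x # u) \<longrightarrow> (x # u) ! Suc k \<noteq> inv_letter ((x # u) ! k)"]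
  show ?thesis
    unfolding reduced_def by (cases u) auto
qed

lemma reduced_push: "reduced u \<Longrightarrow> reduced (push x u)"
  by (cases u) (auto simp: reduced_Cons)

lemma reduced_free_reduce: "reduced (free_reduce u)"
  unfolding free_reduce_def
  by (induction u) (simp_all add: reduced_push)

lemma push_push_inv: "reduced u \<Longrightarrow> push x (push (inv_letter x) u) = u"
  by (cases u; cases "tl u") (auto simp: reduced_Cons)

lemma free_reduce_append: "free_reduce (u @ v) = foldr push u (free_reduce v)"
  by (simp add: free_reduce_def)

lemma free_reduce_cancels: "cancels u v \<Longrightarrow> free_reduce u = free_reduce v"
proof (induction rule: cancels.induct)
  case (1 u x v)
  have "free_reduce (x # inv_letter x # v) = free_reduce v"
    using push_push_inv[OF reduced_free_reduce, of x v] by (simp add: free_reduce_def)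
  then show ?case
    by (simp add: free_reduce_append)
qed

lemma cancels_Cons: "cancels u v \<Longrightarrow> cancels (x # u) (x # v)"
proof (induction rule: cancels.induct)
  case (1 u y v)
  show ?case using cancels.intros[of "x # u" y v] by simp
qed

lemma cancels_free_reduce: "cancels\<^sup>*\<^sup>* u (free_reduce u)"
proof (induction u)
  case Nil
  show ?case by (simp add: free_reduce_def)
next
  case (Cons x u)
  from Cons.IH have "cancels\<^sup>*\<^sup>* (x # u) (x # free_reduce u)"
    by induction (auto intro: rtranclp.rtrancl_into_rtrancl cancels_Cons)
  moreover have "cancels\<^sup>*\<^sup>* (x # v) (push x v)" for v
    using cancels.intros[of "[]" x "tl v"] by (cases v) auto
  ultimately have "cancels\<^sup>*\<^sup>* (x # u) (push x (free_reduce u))"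
    by (meson rtranclp_trans)
  then show ?case by (simp add: free_reduce_def)
qed

lemma free_reduce_reduced: "reduced u \<Longrightarrow> free_reduce u = u"
proof (induction u)
  case Nil
  show ?case by (simp add: free_reduce_def)
next
  case (Cons x u)
  then have "free_reduce (x # u) = push x u"
    by (simp add: free_reduce_def reduced_Cons)
  with Cons.prems show ?case
    by (cases u) (auto simp: reduced_Cons)
qed

lemma free_reduce_unique:
  assumes "cancels\<^sup>*\<^sup>* u v" "reduced v"
  shows "v = free_reduce u"
proof -
  from assms(1) have "free_reduce u = free_reduce v"
    by induction (simp_all add: free_reduce_cancels)
  with assms(2) show ?thesis by (simp add: free_reduce_reduced)
qed

lemma foldr_push_free_reduce:
  assumes "reduced v"
  shows "foldr push u v = foldr push (free_reduce u) v"
proof -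
  have "cancels\<^sup>*\<^sup>* (u @ v) (u' @ v)" if "cancels\<^sup>*\<^sup>* u u'" for u'
    using that
  proof induction
    case (step y z)
    from step.hyps(2) have "cancels (y @ v) (z @ v)"
    proof cases
      case (1 a x b)
      then show ?thesis using cancels.intros[of a x "b @ v"] by simp
    qed
    with step.IH show ?case by simp
  qed simp
  from this[OF cancels_free_reduce] have "free_reduce (u @ v) = free_reduce (free_reduce u @ v)"
    by induction (simp_all add: free_reduce_cancels)
  with assms show ?thesis by (simp add: free_reduce_append free_reduce_reduced)
qed


section \<open>The kernel relations are congruences\<close>

lemma walk_vertex_append_left: "k \<le> length x \<Longrightarrow> walk_vertex (x @ y) k = walk_vertex x k"
  by (induction k) (auto simp: nth_append)

lemma walk_vertex_append_right:
  assumes "x \<in> closed_walks"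
  shows "walk_vertex (x @ y) (length x + k) = walk_vertex y k"
  using assms
  by (induction k) (auto simp: closed_walks_def walk_vertex_append_left nth_append)

lemma closed_walks_Nil: "[] \<in> closed_walks"
  by (simp add: closed_walks_def)

lemma closed_walks_append:
  assumes "x \<in> closed_walks" "y \<in> closed_walks"
  shows "x @ y \<in> closed_walks"
  using assms walk_vertex_append_right[OF assms(1), of y "length y"]
  by (auto simp: closed_walks_def)

lemma traversals_append:
  assumes "x \<in> closed_walks"
  shows "traversals (x @ y) = traversals x @ traversals y"
proof (rule nth_equalityI)
  show "length (traversals (x @ y)) = length (traversals x @ traversals y)"
    by (simp add: traversals_def del: upt_Suc)
next
  fix k assume "k < length (traversals (x @ y))"
  then have k: "k < length x + length y" by (simp add: traversals_def del: upt_Suc)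
  have nth: "traversals w ! k = (walk_vertex w k, walk_vertex w (Suc k))"
    if "k < length w" for w k
    using that by (simp add: traversals_def del: upt_Suc)
  have len: "length (traversals w) = length w" for w
    by (simp add: traversals_def del: upt_Suc)
  show "traversals (x @ y) ! k = (traversals x @ traversals y) ! k"
  proof (cases "k < length x")
    case True
    with k show ?thesis
      by (simp add: nth len nth_append walk_vertex_append_left del: walk_vertex.simps)
  next
    case False
    then obtain j where j: "k = length x + j" using le_Suc_ex not_less by blast
    with k show ?thesis
      using walk_vertex_append_right[OF assms, of y j]
        walk_vertex_append_right[OF assms, of y "Suc j"]
      by (simp add: nth len nth_append del: walk_vertex.simps)
  qed
qed

lemma transition_count_eq: "transition_count w e = count_list (traversals w) e"
proof -
  obtain p q where e: "e = (p, q)" by (cases e)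
  have "count_list (traversals w) e = length (filter ((=) e) (traversals w))"
    by (simp add: count_list_eq_length_filter)
  also have "\<dots> = length (filter (\<lambda>k. e = (walk_vertex w (k - 1), walk_vertex w k))
      [1..<length w + 1])"
    by (simp add: traversals_def filter_map o_def del: upt_Suc)
  also have "\<dots> = card (set (filter (\<lambda>k. e = (walk_vertex w (k - 1), walk_vertex w k))
      [1..<length w + 1]))"
    by (rule distinct_card[symmetric]) simp
  also have "\<dots> = transition_count w e"
    unfolding transition_count_def e by (auto intro!: arg_cong[where f = card])
  finally show ?thesis by simp
qed

lemma equiv_kernel_rel: "equiv closed_walks (kernel_rel r)"
  by (auto simp: equiv_def refl_on_def sym_def trans_def kernel_rel_def)

lemma charge_congruence:
  assumes "(x, x') \<in> kernel_rel charge" "(y, y') \<in> kernel_rel charge"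
  shows "(x @ y, x' @ y') \<in> kernel_rel charge"
proof -
  have "transition_count (u @ v) = (\<lambda>e. transition_count u e + transition_count v e)"
    if "u \<in> closed_walks" for u v
    using that by (simp add: fun_eq_iff transition_count_eq traversals_append)
  moreover have "holonomy (u @ v) = holonomy u * holonomy v" for u v
    by (simp add: holonomy_def)
  ultimately show ?thesis
    using assms by (simp add: kernel_rel_def charge_def closed_walks_append)
qed

lemma loop_word_congruence:
  assumes "(x, x') \<in> kernel_rel loop_word" "(y, y') \<in> kernel_rel loop_word"
  shows "(x @ y, x' @ y') \<in> kernel_rel loop_word"
proof -
  have "loop_word (u @ v) = foldr push (loop_word u) (loop_word v)"
    if "u \<in> closed_walks" for u v
    using that foldr_push_free_reduce[OF reduced_free_reduce]
    by (simp add: loop_word_def traversals_append free_reduce_append)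
  then show ?thesis
    using assms by (simp add: kernel_rel_def closed_walks_append)
qed

end

theory Submission
  imports Defs
begin

text \<open>The loop word does not see backtracking: stepping along the tree edge \<open>0, 1\<close> and back gives
  the empty loop word but nonzero transition counts, so the loop word identifies it with the trivial walk
  while the charge does not.

  For the other direction, transition counts are commutative invariants of concatenated closed
  walks, so any two closed walks with commuting holonomies have concatenations of equal charge in
  the two orders. The square walks \<open>0101\<close> and \<open>1212\<close> even have the same holonomy, since
  \<open>(1 + i)(1 + j) = 1 + i + j + k = (1 + j)(1 + k)\<close>. Their loop words
  \<open>x\<^sub>1\<inverse>\<close> and \<open>x\<^sub>1x\<^sub>5\<inverse>x\<^sub>2\<inverse>\<close>, however, do not commute in the free group.\<close>

lemma charge_append_commute:
  assumes "x \<in> closed_walks" "y \<in> closed_walks"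
    and "holonomy x * holonomy y = holonomy y * holonomy x"
  shows "charge (x @ y) = charge (y @ x)"
  using assms
  by (simp add: charge_def fun_eq_iff transition_count_eq traversals_append holonomy_def)

lemma backtrack_closed: "[0, 0] \<in> closed_walks"
  by (simp add: closed_walks_def basepoint_def)

lemma squares_closed: "[0, 1, 0, 1] \<in> closed_walks" "[1, 2, 1, 2] \<in> closed_walks"
  by (simp_all add: closed_walks_def basepoint_def numeral_eq_Suc)

lemma backtrack_loop_word: "loop_word [0, 0] = loop_word []"
  by (simp add: loop_word_def traversals_def crossing_def cotree_edges_def basepoint_def
      free_reduce_def upt_rec)

lemma backtrack_charge: "charge [0, 0] \<noteq> charge []"
proof -
  have "transition_count [0, 0] (basepoint, flip 0 basepoint) \<noteq> 0"
    by (simp add: transition_count_eq traversals_def basepoint_def upt_rec)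
  moreover have "transition_count [] (basepoint, flip 0 basepoint) = 0"
    by (simp add: transition_count_eq traversals_def)
  ultimately show ?thesis
    by (auto simp: charge_def)
qed

lemma squares_holonomy: "holonomy [0, 1, 0, 1] = holonomy [1, 2, 1, 2]"
  by (simp add: holonomy_def step_quat_def quat_i_def quat_j_def quat_k_def
      one_int_quat_def plus_int_quat_def times_int_quat_def)

lemma loop_word_first_then_second_square:
  "loop_word ([0, 1, 0, 1] @ [1, 2, 1, 2]) = [(5, False), (2, False)]"
  by (simp add: loop_word_def traversals_def crossing_def cotree_edges_def basepoint_def
      free_reduce_def inv_letter_def upt_rec numeral_eq_Suc)

lemma loop_word_second_then_first_square:
  "loop_word ([1, 2, 1, 2] @ [0, 1, 0, 1]) = [(1, True), (5, False), (2, False), (1, False)]"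
  by (simp add: loop_word_def traversals_def crossing_def cotree_edges_def basepoint_def
      free_reduce_def inv_letter_def upt_rec numeral_eq_Suc)

theorem proposition7p2:
  shows "\<not> kernel_rel loop_word \<subseteq> kernel_rel charge
       \<and> \<not> kernel_rel charge \<subseteq> kernel_rel loop_word"
proof
  have "([0, 0], []) \<in> kernel_rel loop_word"
    by (simp add: kernel_rel_def backtrack_closed closed_walks_Nil backtrack_loop_word)
  moreover have "([0, 0], []) \<notin> kernel_rel charge"
    by (simp add: kernel_rel_def backtrack_charge)
  ultimately show "\<not> kernel_rel loop_word \<subseteq> kernel_rel charge"
    by blast
next
  let ?u = "[0, 1, 0, 1] :: nat list" and ?v = "[1, 2, 1, 2] :: nat list"
  have "charge (?u @ ?v) = charge (?v @ ?u)"
    by (rule charge_append_commute[OF squares_closed]) (simp only: squares_holonomy)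
  then have "(?u @ ?v, ?v @ ?u) \<in> kernel_rel charge"
    using closed_walks_append squares_closed unfolding kernel_rel_def by blast
  moreover have "(?u @ ?v, ?v @ ?u) \<notin> kernel_rel loop_word"
    using loop_word_first_then_second_square loop_word_second_then_first_square
    by (auto simp: kernel_rel_def simp del: append.simps One_nat_def)
  ultimately show "\<not> kernel_rel charge \<subseteq> kernel_rel loop_word"
    by blast
qed

end
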